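(* For every $n\ge 2$, the multiring $M(n)$ is not formally real.
   Context: For a positive integer $n$, $\mathbb Z_n=\mathbb Z/n\mathbb Z$, $\mathbb Z_n^\times$ is its group of units, and $S_n=\{u^2:u\in\mathbb Z_n^\times\}$. $M(n)$ denotes the Marshall quotient of $\mathbb Z_n$ by $S_n$: the underlying set is the quotient of $\mathbb Z_n$ by the equivalence relation $a\sim b\iff as=bt$ for some $s,t\in S_n$; the class of $a$ is written $[a]$. The operations are $[a][b]=[ab]$, $-[a]=[-a]$, and the multivalued addition $[a]+[b]=\{[c]: cr=as+bt\text{ for some }r,s,t\in S_n\}$, with zero $[0]$ and unit $[1]$; with these $M(n)$ is a commutative multiring. A multiring $A$ is formally real if $-1\notin\sum A^2$, that is, if $-1$ is not contained in any finite multivalued sum $a_1^2+\cdots+a_k^2$ of squares of elements of $A$. Here finite multivalued sums are defined iteratively: $x_1+\cdots+x_k=\bigcup_{y\in x_1+\cdots+x_{k-1}}(y+x_k)$, the one-term sum of $x_1$ being $\{x_1\}$. *)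

theory Defs
  imports "HOL-Number_Theory.Residues"
begin

text \<open>
  The raw structure of a commutative multiring: \<open>madd A x y\<close> is the set of values of
  the multivalued sum of \<open>x\<close> and \<open>y\<close>. The fields \<open>mult\<close> and \<open>one\<close> are inherited from \<open>monoid\<close>.
\<close>

record 'a multiring = "'a monoid" +
  mzero :: 'a
  mneg :: "'a \<Rightarrow> 'a"
  madd :: "'a \<Rightarrow> 'a \<Rightarrow> 'a set"

text \<open>The multivalued sum of the \<open>k + 1\<close> terms \<open>x 0, \<dots>, x k\<close>.\<close>

primrec msum :: "('a, 'm) multiring_scheme \<Rightarrow> (nat \<Rightarrow> 'a) \<Rightarrow> nat \<Rightarrow> 'a set" where
  "msum A x 0 = {x 0}"
| "msum A x (Suc k) = (\<Union>y \<in> msum A x k. madd A y (x (Suc k)))"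

definition formally_real :: "('a, 'm) multiring_scheme \<Rightarrow> bool" where
  "formally_real A \<longleftrightarrow>
     \<not> (\<exists>k a. (\<forall>i\<le>k. a i \<in> carrier A) \<and>
              mneg A \<one>\<^bsub>A\<^esub> \<in> msum A (\<lambda>i. a i \<otimes>\<^bsub>A\<^esub> a i) k)"

definition marshall_rel :: "('a, 'm) ring_scheme \<Rightarrow> 'a set \<Rightarrow> ('a \<times> 'a) set" where
  "marshall_rel R S =
     {(a, b). a \<in> carrier R \<and> b \<in> carrier R \<and>
              (\<exists>s\<in>S. \<exists>t\<in>S. a \<otimes>\<^bsub>R\<^esub> s = b \<otimes>\<^bsub>R\<^esub> t)}"

abbreviation marshall_class :: "('a, 'm) ring_scheme \<Rightarrow> 'a set \<Rightarrow> 'a \<Rightarrow> 'a set" where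
  "marshall_class R S a \<equiv> marshall_rel R S `` {a}"

text \<open>
  Operations on classes are given through all representatives; the lemmas below
  recover the defining equations on a single choice of representatives.
\<close>

definition marshall_quotient ::
    "('a, 'm) ring_scheme \<Rightarrow> 'a set \<Rightarrow> 'a set multiring" where
  "marshall_quotient R S =
     \<lparr>carrier = carrier R // marshall_rel R S,
      monoid.mult = (\<lambda>X Y. \<Union>a\<in>X. \<Union>b\<in>Y. marshall_class R S (a \<otimes>\<^bsub>R\<^esub> b)),
      one = marshall_class R S \<one>\<^bsub>R\<^esub>,
      mzero = marshall_class R S \<zero>\<^bsub>R\<^esub>,
      mneg = (\<lambda>X. \<Union>a\<in>X. marshall_class R S (\<ominus>\<^bsub>R\<^esub> a)),
      madd = (\<lambda>X Y. {marshall_class R S c | c. c \<in> carrier R \<and>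
                 (\<exists>a\<in>X. \<exists>b\<in>Y. \<exists>r\<in>S. \<exists>s\<in>S. \<exists>t\<in>S.
                    c \<otimes>\<^bsub>R\<^esub> r = a \<otimes>\<^bsub>R\<^esub> s \<oplus>\<^bsub>R\<^esub> b \<otimes>\<^bsub>R\<^esub> t)})\<rparr>"

text \<open>\<open>Z n\<close> is modelled on the carrier \<open>{0..n - 1}\<close> of integers by \<open>residue_ring\<close>.\<close>

definition unit_squares :: "nat \<Rightarrow> int set" where
  "unit_squares n =
     {u [^]\<^bsub>residue_ring (int n)\<^esub> (2::nat) | u. u \<in> Units (residue_ring (int n))}"

definition M :: "nat \<Rightarrow> int set multiring" where
  "M n = marshall_quotient (residue_ring (int n)) (unit_squares n)"

locale marshall = cring R for R (structure) +
  fixes S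
  assumes S_subset: "S \<subseteq> carrier R"
    and S_one: "\<one> \<in> S"
    and S_mult: "s \<in> S \<Longrightarrow> t \<in> S \<Longrightarrow> s \<otimes> t \<in> S"
begin

lemma S_carrier: "s \<in> S \<Longrightarrow> s \<in> carrier R"
  using S_subset by auto

lemma equiv_marshall: "equiv (carrier R) (marshall_rel R S)"
proof (rule equivI)
  show "marshall_rel R S \<subseteq> carrier R \<times> carrier R"
    by (auto simp: marshall_rel_def)
  show "refl_on (carrier R) (marshall_rel R S)"
    using S_one by (auto simp: marshall_rel_def refl_on_def)
  show "sym (marshall_rel R S)"
  proof (rule symI)
    fix a b assume "(a, b) \<in> marshall_rel R S"
    then obtain s t where *: "a \<in> carrier R" "b \<in> carrier R" "s \<in> S" "t \<in> S"
      "b \<otimes> t = a \<otimes> s" by (auto simp: marshall_rel_def)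
    then show "(b, a) \<in> marshall_rel R S"
      unfolding marshall_rel_def by blast
  qed
  show "trans (marshall_rel R S)"
  proof (rule transI)
    fix a b c assume "(a, b) \<in> marshall_rel R S" "(b, c) \<in> marshall_rel R S"
    then obtain s t u v where *: "a \<in> carrier R" "b \<in> carrier R" "c \<in> carrier R"
      "s \<in> S" "t \<in> S" "u \<in> S" "v \<in> S" "a \<otimes> s = b \<otimes> t" "b \<otimes> u = c \<otimes> v"
      by (auto simp: marshall_rel_def)
    have "a \<otimes> (s \<otimes> u) = (a \<otimes> s) \<otimes> u"
      using *(1-7) S_carrier by (simp add: m_assoc)
    also have "\<dots> = (b \<otimes> t) \<otimes> u" using *(8) by simp
    also have "\<dots> = (b \<otimes> u) \<otimes> t" using *(1-7) S_carrier by (simp add: m_ac)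
    also have "\<dots> = c \<otimes> (v \<otimes> t)" using * S_carrier by (simp add: m_assoc)
    finally have "a \<otimes> (s \<otimes> u) = c \<otimes> (v \<otimes> t)" .
    with *(1,3) S_mult[OF *(4,6)] S_mult[OF *(7,5)] show "(a, c) \<in> marshall_rel R S"
      unfolding marshall_rel_def by blast
  qed
qed

lemma class_mult:
  assumes "a \<in> carrier R" "b \<in> carrier R"
  shows "marshall_class R S a \<otimes>\<^bsub>marshall_quotient R S\<^esub> marshall_class R S b
       = marshall_class R S (a \<otimes> b)"
proof -
  have "(\<lambda>a b. marshall_class R S (a \<otimes> b)) respects2 marshall_rel R S"
  proof (rule congruent2_commuteI[OF equiv_marshall])
    fix a b assume "a \<in> carrier R" "b \<in> carrier R"
    then show "marshall_class R S (a \<otimes> b) = marshall_class R S (b \<otimes> a)"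
      by (simp add: m_comm)
  next
    fix a b c assume c: "c \<in> carrier R" and "(a, b) \<in> marshall_rel R S"
    then obtain s t where *: "a \<in> carrier R" "b \<in> carrier R" "s \<in> S" "t \<in> S"
      "a \<otimes> s = b \<otimes> t" by (auto simp: marshall_rel_def)
    have "(c \<otimes> a) \<otimes> s = (c \<otimes> b) \<otimes> t" using * c S_carrier by (simp add: m_assoc)
    then have "(c \<otimes> a, c \<otimes> b) \<in> marshall_rel R S"
      using * c unfolding marshall_rel_def by auto
    then show "marshall_class R S (c \<otimes> a) = marshall_class R S (c \<otimes> b)"
      by (rule equiv_class_eq[OF equiv_marshall])
  qed
  from UN_equiv_class2[OF equiv_marshall equiv_marshall this assms] show ?thesis
    by (simp add: marshall_quotient_def)
qed

lemma class_neg: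
  assumes "a \<in> carrier R"
  shows "mneg (marshall_quotient R S) (marshall_class R S a) = marshall_class R S (\<ominus> a)"
proof -
  have "(\<lambda>a. marshall_class R S (\<ominus> a)) respects marshall_rel R S"
  proof (rule congruentI)
    fix a b assume "(a, b) \<in> marshall_rel R S"
    then obtain s t where *: "a \<in> carrier R" "b \<in> carrier R" "s \<in> S" "t \<in> S"
      "a \<otimes> s = b \<otimes> t" by (auto simp: marshall_rel_def)
    then have "\<ominus> a \<otimes> s = \<ominus> b \<otimes> t" using S_carrier by (simp add: l_minus)
    then have "(\<ominus> a, \<ominus> b) \<in> marshall_rel R S"
      using * unfolding marshall_rel_def by auto
    then show "marshall_class R S (\<ominus> a) = marshall_class R S (\<ominus> b)"
      by (rule equiv_class_eq[OF equiv_marshall])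
  qed
  from UN_equiv_class[OF equiv_marshall this assms] show ?thesis
    by (simp add: marshall_quotient_def)
qed

lemma class_add:
  assumes "a \<in> carrier R" "b \<in> carrier R"
  shows "madd (marshall_quotient R S) (marshall_class R S a) (marshall_class R S b)
       = {marshall_class R S c | c. c \<in> carrier R \<and>
            (\<exists>r\<in>S. \<exists>s\<in>S. \<exists>t\<in>S. c \<otimes> r = a \<otimes> s \<oplus> b \<otimes> t)}"
proof -
  have "(\<exists>a'\<in>marshall_class R S a. \<exists>b'\<in>marshall_class R S b. \<exists>r\<in>S. \<exists>s\<in>S. \<exists>t\<in>S.
            c \<otimes> r = a' \<otimes> s \<oplus> b' \<otimes> t)
      \<longleftrightarrow> (\<exists>r\<in>S. \<exists>s\<in>S. \<exists>t\<in>S. c \<otimes> r = a \<otimes> s \<oplus> b \<otimes> t)" (is "?L \<longleftrightarrow> ?R")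
    if c: "c \<in> carrier R" for c
  proof
    assume ?L
    then obtain a' b' u v w z r s t where *: "a' \<in> carrier R" "b' \<in> carrier R"
      "u \<in> S" "v \<in> S" "a \<otimes> u = a' \<otimes> v" "w \<in> S" "z \<in> S" "b \<otimes> w = b' \<otimes> z"
      "r \<in> S" "s \<in> S" "t \<in> S" "c \<otimes> r = a' \<otimes> s \<oplus> b' \<otimes> t"
      by (auto simp: marshall_rel_def)
    note car = assms c *(1,2) *(3,4,6,7,9-11)[THEN S_carrier]
    have "c \<otimes> (r \<otimes> (v \<otimes> z)) = (c \<otimes> r) \<otimes> (v \<otimes> z)" using car by (simp add: m_assoc)
    also have "\<dots> = (a' \<otimes> s) \<otimes> (v \<otimes> z) \<oplus> (b' \<otimes> t) \<otimes> (v \<otimes> z)"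
      unfolding *(12) using car by (simp add: l_distr)
    also have "\<dots> = (a' \<otimes> v) \<otimes> (s \<otimes> z) \<oplus> (b' \<otimes> z) \<otimes> (t \<otimes> v)"
      using car by (simp add: m_ac)
    also have "\<dots> = a \<otimes> (u \<otimes> (s \<otimes> z)) \<oplus> b \<otimes> (w \<otimes> (t \<otimes> v))"
      unfolding *(5)[symmetric] *(8)[symmetric] using car by (simp add: m_assoc)
    finally have "c \<otimes> (r \<otimes> (v \<otimes> z)) = a \<otimes> (u \<otimes> (s \<otimes> z)) \<oplus> b \<otimes> (w \<otimes> (t \<otimes> v))" .
    moreover have "r \<otimes> (v \<otimes> z) \<in> S" "u \<otimes> (s \<otimes> z) \<in> S" "w \<otimes> (t \<otimes> v) \<in> S"
      using * by (auto intro!: S_mult)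
    ultimately show ?R by blast
  next
    assume ?R
    moreover have "a \<in> marshall_class R S a" "b \<in> marshall_class R S b"
      using assms equiv_class_self[OF equiv_marshall] by auto
    ultimately show ?L by blast
  qed
  then show ?thesis by (simp add: marshall_quotient_def cong: conj_cong)
qed

end

lemma marshall_residue:
  assumes "n \<ge> 2"
  shows "marshall (residue_ring (int n)) (unit_squares n)"
proof -
  interpret residues "int n" "residue_ring (int n)"
    using assms by unfold_locales auto
  show ?thesis
  proof
    show "unit_squares n \<subseteq> carrier (residue_ring (int n))"
      unfolding unit_squares_def using nat_pow_closed[OF Units_closed] by auto
    show "\<one>\<^bsub>residue_ring (int n)\<^esub> \<in> unit_squares n"
      unfolding unit_squares_def using Units_one_closed nat_pow_one by (metis (mono_tags, lifting) mem_Collect_eq)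
    fix s t assume "s \<in> unit_squares n" "t \<in> unit_squares n"
    then obtain u v where *: "u \<in> Units (residue_ring (int n))" "v \<in> Units (residue_ring (int n))"
      "s = u [^]\<^bsub>residue_ring (int n)\<^esub> (2::nat)" "t = v [^]\<^bsub>residue_ring (int n)\<^esub> (2::nat)"
      by (auto simp: unit_squares_def)
    then have "s \<otimes>\<^bsub>residue_ring (int n)\<^esub> t
        = (u \<otimes>\<^bsub>residue_ring (int n)\<^esub> v) [^]\<^bsub>residue_ring (int n)\<^esub> (2::nat)"
      using nat_pow_distrib[of u v 2] Units_closed by simp
    then show "s \<otimes>\<^bsub>residue_ring (int n)\<^esub> t \<in> unit_squares n"
      unfolding unit_squares_def using *(1,2) Units_m_closed by blast
  qed
qed

end

theory Submission
  imports Defs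
begin

text \<open>
  The multivalued sum of the classes of \<open>f 0, \<dots>, f k\<close> always contains the class of the ordinary
  sum \<open>f 0 + \<dots> + f k\<close> (\<open>class_sum_mem_msum\<close>). In particular, the multiples \<open>1 + \<dots> + 1\<close> of the
  unit of a ring give elements \<open>[1 + \<dots> + 1]\<close> of the sums \<open>[1]\<^sup>2 + \<dots> + [1]\<^sup>2\<close> in its Marshall
  quotient. If some positive multiple of \<open>1\<close> vanishes, then \<open>-1\<close> is itself such a multiple, so
  \<open>[-1]\<close> is a sum of squares. This happens in every finite ring, by Lagrange's theorem in the
  additive group, and so in \<open>\<int>/n\<int>\<close>.
\<close>

context marshall
begin

text \<open>The relation \<open>c r = a s + b t\<close> is solved by \<open>c = a + b\<close> and \<open>r = s = t = 1\<close>.\<close>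

lemma class_add_mem_madd:
  assumes "a \<in> carrier R" "b \<in> carrier R"
  shows "marshall_class R S (a \<oplus> b)
           \<in> madd (marshall_quotient R S) (marshall_class R S a) (marshall_class R S b)"
proof -
  have "(a \<oplus> b) \<otimes> \<one> = a \<otimes> \<one> \<oplus> b \<otimes> \<one>"
    using assms by simp
  then show ?thesis
    unfolding class_add[OF assms] using assms S_one by blast
qed

lemma class_sum_mem_msum:
  assumes "\<And>i. f i \<in> carrier R"
  shows "marshall_class R S (\<Oplus>i\<in>{..k}. f i)
           \<in> msum (marshall_quotient R S) (\<lambda>i. marshall_class R S (f i)) k"
proof (induction k)
  case 0
  show ?case using assms by simp
next
  case (Suc k)
  have "(\<Oplus>i\<in>{..Suc k}. f i) = (\<Oplus>i\<in>{..k}. f i) \<oplus> f (Suc k)"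
    using assms by (simp add: finsum_Suc a_comm)
  moreover have "marshall_class R S ((\<Oplus>i\<in>{..k}. f i) \<oplus> f (Suc k))
      \<in> madd (marshall_quotient R S) (marshall_class R S (\<Oplus>i\<in>{..k}. f i))
          (marshall_class R S (f (Suc k)))"
    using assms by (intro class_add_mem_madd) auto
  ultimately show ?case
    using Suc.IH by auto
qed

lemma not_formally_real_if_multiple_of_one_zero:
  fixes N :: nat
  assumes "N > 0" and N: "[N] \<cdot> \<one> = \<zero>"
  shows "\<not> formally_real (marshall_quotient R S)"
proof -
  let ?Q = "marshall_quotient R S"
  let ?u = "marshall_class R S \<one>"
  obtain m where m: "N = Suc m"
    using assms(1) gr0_conv_Suc by blast
  (* -1 is the sum of N - 1 ones, which is an empty sum if N = 1; the sum of 2 N - 1 ones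
     has the same value and always has a term. *)
  define k where "k = 2 * m"
  have "[Suc k] \<cdot> \<one> \<oplus> \<one> = [(N + N)] \<cdot> \<one>"
    by (simp add: k_def m add.nat_pow_Suc mult_2)
  also have "\<dots> = \<zero>"
    using N by (simp add: add.nat_pow_mult[symmetric])
  finally have "\<ominus> \<one> = [Suc k] \<cdot> \<one>"
    by (simp add: minus_equality)
  also have "\<dots> = (\<Oplus>i\<in>{..k}. \<one>)"
    by (simp add: add.finprod_const)
  finally have "marshall_class R S (\<ominus> \<one>) \<in> msum ?Q (\<lambda>i. ?u) k"
    using class_sum_mem_msum[of "\<lambda>i. \<one>" k] by simp
  moreover have "mneg ?Q \<one>\<^bsub>?Q\<^esub> = marshall_class R S (\<ominus> \<one>)"
    using class_neg[of \<one>] by (simp add: marshall_quotient_def)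
  moreover have "?u \<otimes>\<^bsub>?Q\<^esub> ?u = ?u"
    by (simp add: class_mult)
  moreover have "?u \<in> carrier ?Q"
    by (simp add: marshall_quotient_def quotientI)
  ultimately show ?thesis
    unfolding formally_real_def not_not
    by (intro exI[of _ k] exI[of _ "\<lambda>i. ?u"]) simp
qed

lemma not_formally_real_if_finite:
  assumes "finite (carrier R)"
  shows "\<not> formally_real (marshall_quotient R S)"
proof (rule not_formally_real_if_multiple_of_one_zero)
  show "order (add_monoid R) > 0"
    using assms by (simp add: add.order_gt_0_iff_finite)
  show "[order (add_monoid R)] \<cdot> \<one> = \<zero>"
    using add.pow_order_eq_1[of \<one>] by simp
qed

end

theorem theorem5p10:
  fixes n :: nat
  assumes "n \<ge> 2"
  shows "\<not> formally_real (M n)"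
proof -
  interpret marshall "residue_ring (int n)" "unit_squares n"
    using assms by (rule marshall_residue)
  have "finite (carrier (residue_ring (int n)))"
    by (simp add: residue_ring_def)
  then show ?thesis
    unfolding M_def by (rule not_formally_real_if_finite)
qed

end
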